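(* Every colored $n$-vertex graph $G$ has a subgraph $H$ with the following property: for every two vertices $u,v$ and every set $C$ of at most $\lambda$ colors, $u$ and $v$ are connected in $H-C$ if and only if they are connected in $G-C$. Moreover, $H$ can be chosen so that: - $|E(H)|=O(\lambda n)$ if either only the edges or only the vertices of $G$ are colored; - $|E(H)|=O(\lambda^2 n)$ if both the vertices and the edges are colored. These bounds are worst-case optimal up to constant factors.
   Context: Colors are assigned arbitrarily (no legality restrictions) to edges, to vertices, or to both. In the latter case, a color may appear on both edges and vertices. For a set $C$ of colors, $G-C$ is obtained from $G$ by deleting every edge that has a color in $C$, or that has an endpoint whose color is in $C$ (only the applicable condition is used when only edges or only vertices are colored). $H-C$ is defined in the same way, with $H$ inheriting the colors of $G$. *)

theory Defs
  imports Complex_Main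
begin

record 'v ugraph =
  verts :: "'v set"
  edges :: "'v set set"

definition simple_graph :: "'v ugraph \<Rightarrow> bool" where
  "simple_graph G \<longleftrightarrow> finite (verts G) \<and> (\<forall>e\<in>edges G. e \<subseteq> verts G \<and> card e = 2)"

definition subgraph :: "'v ugraph \<Rightarrow> 'v ugraph \<Rightarrow> bool" where
  "subgraph H G \<longleftrightarrow> simple_graph H \<and> verts H \<subseteq> verts G \<and> edges H \<subseteq> edges G"

definition connected_in :: "'v ugraph \<Rightarrow> 'v \<Rightarrow> 'v \<Rightarrow> bool" where
  "connected_in G u v \<longleftrightarrow>
     u \<in> verts G \<and> v \<in> verts G \<and> (\<lambda>x y. {x, y} \<in> edges G)\<^sup>*\<^sup>* u v"

text \<open>A coloring is a total function on vertices or on vertex sets; only its values on the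
  vertices and edges of the graph at hand matter, so a subgraph inherits its colors by using the
  same coloring. In the last case edges and vertices share one palette of colors.\<close>

datatype ('v, 'c) coloring =
    Edge_Coloring "'v set \<Rightarrow> 'c"
  | Vertex_Coloring "'v \<Rightarrow> 'c"
  | Edge_Vertex_Coloring "'v set \<Rightarrow> 'c" "'v \<Rightarrow> 'c"

fun hit_by :: "('v, 'c) coloring \<Rightarrow> 'c set \<Rightarrow> 'v set \<Rightarrow> bool" where
  "hit_by (Edge_Coloring f) C e \<longleftrightarrow> f e \<in> C"
| "hit_by (Vertex_Coloring g) C e \<longleftrightarrow> (\<exists>x\<in>e. g x \<in> C)"
| "hit_by (Edge_Vertex_Coloring f g) C e \<longleftrightarrow> f e \<in> C \<or> (\<exists>x\<in>e. g x \<in> C)"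

text \<open>The graph \<open>G - C\<close>: edges are deleted, but all vertices remain, including those with a
  color in \<open>C\<close> (which become isolated).\<close>

definition delete_colors :: "('v, 'c) coloring \<Rightarrow> 'v ugraph \<Rightarrow> 'c set \<Rightarrow> 'v ugraph" where
  "delete_colors col G C = \<lparr>verts = verts G, edges = {e \<in> edges G. \<not> hit_by col C e}\<rparr>"

text \<open>Since \<open>u = v\<close> is allowed, such an \<open>H\<close> has the same vertices as \<open>G\<close>.\<close>

definition preserves_connectivity ::
  "('v, 'c) coloring \<Rightarrow> nat \<Rightarrow> 'v ugraph \<Rightarrow> 'v ugraph \<Rightarrow> bool" where
  "preserves_connectivity col l G H \<longleftrightarrow>
     subgraph H G \<and>
     (\<forall>u\<in>verts G. \<forall>v\<in>verts G. \<forall>C. finite C \<and> card C \<le> l \<longrightarrow>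
        (connected_in (delete_colors col H C) u v \<longleftrightarrow> connected_in (delete_colors col G C) u v))"

text \<open>The size bound is claimed, up to constant factors, for \<open>l \<ge> 1\<close>.\<close>

fun size_bound :: "('v, 'c) coloring \<Rightarrow> nat \<Rightarrow> nat \<Rightarrow> nat" where
  "size_bound (Edge_Coloring _) l n = l * n"
| "size_bound (Vertex_Coloring _) l n = l * n"
| "size_bound (Edge_Vertex_Coloring _ _) l n = l\<^sup>2 * n"

end

theory Submission
  imports Defs
begin

text \<open>For the upper bounds take \<open>H\<close> minimal. Then every edge \<open>e\<close> has a set \<open>C e\<close> of at most \<open>l\<close>
  colors, none of them on \<open>e\<close> or on colored ends of \<open>e\<close>, such that \<open>e\<close> is a bridge of
  \<open>H - C e\<close>. Sample every color with probability \<open>p = 1 / (2 * l)\<close>. The edges all of whose (at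
  most 1, 2 or 3) colors are sampled while \<open>C e\<close> is avoided form a forest on the surviving
  vertices; compare the expected number of edges with the expected number of surviving vertices
  (\<open>n\<close> if vertices are uncolored, \<open>p * n\<close> otherwise).

  For the lower bounds take a complete bipartite graph between about \<open>l / 2\<close> (or \<open>l\<^sup>2 / 4\<close>) vertices
  and the remaining ones, colored such that for every vertex \<open>a\<close> on the small side at most \<open>l\<close>
  colors kill exactly the edges that miss \<open>a\<close>. With two kinds of colors \<open>a\<close> is encoded by a pair:
  the first component colors the vertex \<open>a\<close>, the second its edges.\<close>

section \<open>Connectivity and forests\<close>

abbreviation conn :: "'v set set \<Rightarrow> 'v \<Rightarrow> 'v \<Rightarrow> bool" where
  "conn F \<equiv> (\<lambda>x y. {x, y} \<in> F)\<^sup>*\<^sup>*"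

lemma conn_mono: "conn F x y \<Longrightarrow> F \<subseteq> F' \<Longrightarrow> conn F' x y"
  by (erule rtranclp_mono[THEN predicate2D, rotated]) auto

lemma conn_sym: "conn F x y \<Longrightarrow> conn F y x"
proof (induction rule: rtranclp_induct)
  case (step y z)
  have "{z, y} \<in> F" using step(2) by (simp add: insert_commute)
  then show ?case using step.IH by (rule converse_rtranclp_into_rtranclp)
qed simp

lemma conn_replace_edge:
  assumes "conn (insert {a, b} F) x y" and "conn F a b"
  shows "conn F x y"
  using assms(1)
proof (induction rule: rtranclp_induct)
  case (step y z)
  have "conn F y z"
    using step(2) assms(2) conn_sym[OF assms(2)] by (auto simp: doubleton_eq_iff)
  with step.IH show ?case by simp
qed simp

text \<open>If every edge is a bridge, the edges form a forest. They are added one at a time while a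
  labelling \<open>r\<close> is kept whose classes stay inside connected components; each new edge
  joins two classes, so every edge costs one label.\<close>

lemma card_forest_le:
  assumes "finite V" and "finite F"
    and "\<And>e. e \<in> F \<Longrightarrow> \<exists>x\<in>V. \<exists>y\<in>V. e = {x, y} \<and> \<not> conn (F - {e}) x y"
  shows "card F \<le> card V"
proof -
  have "\<exists>r :: 'a \<Rightarrow> 'a. (\<forall>x\<in>V. \<forall>y\<in>V. r x = r y \<longrightarrow> conn F x y) \<and> card (r ` V) + card F \<le> card V"
    using assms(2,3)
  proof (induction F rule: finite_induct)
    case empty
    show ?case by (rule exI[of _ id]) auto
  next
    case (insert e F)
    have "\<exists>x\<in>V. \<exists>y\<in>V. e' = {x, y} \<and> \<not> conn (F - {e'}) x y" if e': "e' \<in> F" for e'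
    proof -
      obtain x y where "x \<in> V" "y \<in> V" "e' = {x, y}" "\<not> conn (insert e F - {e'}) x y"
        using insert.prems[OF insertI2[OF e']] by blast
      moreover have "F - {e'} \<subseteq> insert e F - {e'}" by auto
      ultimately show ?thesis using conn_mono by metis
    qed
    then obtain r :: "'a \<Rightarrow> 'a" where r: "\<And>x y. x \<in> V \<Longrightarrow> y \<in> V \<Longrightarrow> r x = r y \<Longrightarrow> conn F x y"
      and card_r: "card (r ` V) + card F \<le> card V"
      using insert.IH by blast
    obtain a b where ab: "a \<in> V" "b \<in> V" "e = {a, b}" "\<not> conn F a b"
      using insert.prems[of e] insert.hyps by auto
    then have neq: "r a \<noteq> r b" using r by blast
    \<comment> \<open>Merges the class of \<open>b\<close> into that of \<open>a\<close>, so the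
      label \<open>r b\<close> disappears.\<close>
    define r' where "r' = (\<lambda>x. if r x = r b then r a else r x)"
    have mono: "conn F x y \<Longrightarrow> conn (insert e F) x y" for x y
      by (erule conn_mono) auto
    have joined: "conn (insert e F) a b" using ab(3) by auto
    have "conn (insert e F) x y" if xy: "x \<in> V" "y \<in> V" "r' x = r' y" for x y
    proof -
      consider "r x = r y" | "r x = r b" "r y = r a" | "r x = r a" "r y = r b"
        using xy(3) unfolding r'_def by metis
      then show ?thesis
      proof cases
        case 1
        then show ?thesis using r xy mono by blast
      next
        case 2
        then have "conn (insert e F) x b" "conn (insert e F) a y"
          using r xy ab mono by metis+
        then show ?thesis using conn_sym[OF joined] by (meson rtranclp_trans)
      next
        case 3
        then have "conn (insert e F) x a" "conn (insert e F) b y"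
          using r xy ab mono by metis+
        then show ?thesis using joined by (meson rtranclp_trans)
      qed
    qed
    moreover have "r' ` V \<subseteq> r ` V - {r b}"
      using ab neq by (auto simp: r'_def)
    then have "card (r' ` V) \<le> card (r ` V) - 1"
      using card_mono[of "r ` V - {r b}" "r' ` V"] assms(1) ab by (simp add: card_Diff_singleton)
    moreover have "card (r ` V) > 0" using assms(1) ab by (auto simp: card_gt_0_iff)
    ultimately show ?case using card_r insert.hyps by (intro exI[of _ r']) auto
  qed
  then show ?thesis by auto
qed

section \<open>Random sampling of colors\<close>

text \<open>The probability of \<open>R\<close> when each element of \<open>P\<close> is sampled independently with
  probability \<open>p\<close>.\<close>

definition sample_weight :: "real \<Rightarrow> 'c set \<Rightarrow> 'c set \<Rightarrow> real" where
  "sample_weight p P R = p ^ card R * (1 - p) ^ card (P - R)"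

text \<open>The event splits over single colors, so the sum over \<open>R\<close> is the expansion
  of a product with one factor per color of \<open>P\<close>. Colors of \<open>B\<close> outside
  \<open>P\<close> are never sampled, hence the exponent \<open>card (B \<inter> P)\<close>.\<close>

lemma sum_sample_weight:
  assumes "finite P" "A \<subseteq> P" "A \<inter> B = {}"
  shows "(\<Sum>R\<in>Pow P. sample_weight p P R * of_bool (A \<subseteq> R \<and> B \<inter> R = {})) =
    p ^ card A * (1 - p) ^ card (B \<inter> P)"
proof -
  \<comment> \<open>\<open>f c\<close> is the factor of a sampled color, \<open>g c\<close> that of
    an unsampled one; a zero marks a choice that violates the event.\<close>
  define f g where "f c = (if c \<in> B then 0 else p)" and "g c = (if c \<in> A then 0 else 1 - p)" for c
  have f: "prod f R = (if B \<inter> R = {} then p ^ card R else 0)" if "R \<subseteq> P" for R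
  proof (cases "B \<inter> R = {}")
    case True
    then have "prod f R = (\<Prod>c\<in>R. p)" by (intro prod.cong) (auto simp: f_def)
    with True show ?thesis by simp
  next
    case False
    then have "\<exists>c\<in>R. f c = 0" by (auto simp: f_def)
    with False show ?thesis using finite_subset[OF that assms(1)] by simp
  qed
  have g: "prod g (P - R) = (if A \<subseteq> R then (1 - p) ^ card (P - R) else 0)" if "R \<subseteq> P" for R
  proof (cases "A \<subseteq> R")
    case True
    then have "prod g (P - R) = (\<Prod>c\<in>P - R. 1 - p)" by (intro prod.cong) (auto simp: g_def)
    with True show ?thesis by simp
  next
    case False
    then have "\<exists>c\<in>P - R. g c = 0" using assms(2) by (auto simp: g_def)
    with False show ?thesis using assms(1) by simp
  qed
  have "(\<Sum>R\<in>Pow P. sample_weight p P R * of_bool (A \<subseteq> R \<and> B \<inter> R = {})) =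
      (\<Sum>R\<in>Pow P. prod f R * prod g (P - R))"
    by (intro sum.cong) (auto simp: f g sample_weight_def)
  also have "\<dots> = (\<Prod>c\<in>P. f c + g c)"
    using assms(1) by (simp add: prod_add)
  also have "\<dots> = (\<Prod>c\<in>P. (if c \<in> A then p else 1) * (if c \<in> B then 1 - p else 1))"
    using assms(3) by (intro prod.cong) (auto simp: f_def g_def)
  also have "\<dots> = p ^ card A * (1 - p) ^ card (B \<inter> P)"
    using assms(1,2) by (simp add: prod.distrib flip: prod.inter_restrict)
      (simp add: Int_absorb2 Int_commute)
  finally show ?thesis .
qed

text \<open>A certificate that \<open>e\<close> cannot be dropped. \<open>A e\<close> stands for the
  colors whose deletion removes \<open>e\<close>, so \<open>e\<close> survives the deletion of
  \<open>C\<close> and is a bridge of what remains.\<close>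

definition separates ::
  "('v set \<Rightarrow> 'c set) \<Rightarrow> nat \<Rightarrow> 'v set \<Rightarrow> 'v set set \<Rightarrow> 'v set \<Rightarrow> 'c set \<Rightarrow> bool" where
  "separates A l V E e C \<longleftrightarrow> finite C \<and> card C \<le> l \<and> A e \<inter> C = {} \<and>
    (\<exists>x\<in>V. \<exists>y\<in>V. e = {x, y} \<and> \<not> conn {e' \<in> E - {e}. A e' \<inter> C = {}} x y)"

text \<open>The left side bounds the expected number of surviving edges from below. They form a
  forest on the vertices whose colors are all sampled, and the right side is the expected number of
  those vertices.\<close>

lemma card_sparse_le:
  fixes A :: "'v set \<Rightarrow> 'c set" and vc :: "'v \<Rightarrow> 'c set" and p :: real
  assumes fin: "finite V" "finite E" "\<And>e. e \<in> E \<Longrightarrow> finite (A e)" "\<And>v. v \<in> V \<Longrightarrow> finite (vc v)"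
    and card_A: "\<And>e. e \<in> E \<Longrightarrow> card (A e) \<le> k"
    and card_vc: "\<And>v. v \<in> V \<Longrightarrow> card (vc v) = j"
    and vc_A: "\<And>e x. e \<in> E \<Longrightarrow> x \<in> e \<Longrightarrow> vc x \<subseteq> A e"
    and p: "0 \<le> p" "p \<le> 1"
    and sep: "\<And>e. e \<in> E \<Longrightarrow> \<exists>C. separates A l V E e C"
  shows "real (card E) * (p ^ k * (1 - p) ^ l) \<le> real (card V) * p ^ j"
proof -
  obtain C where sep_C: "\<And>e. e \<in> E \<Longrightarrow> separates A l V E e (C e)"
    using sep by metis
  then have C: "finite (C e)" "card (C e) \<le> l" "A e \<inter> C e = {}" if "e \<in> E" for e
    using that by (auto simp: separates_def)
  \<comment> \<open>These finitely many colors suffice for the sampling: any other color can occur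
    only in the sets \<open>C e\<close>.\<close>
  define P where "P = (\<Union>e\<in>E. A e) \<union> (\<Union>v\<in>V. vc v)"
  have finP: "finite P" using fin by (auto simp: P_def)
  define survives where "survives e R \<longleftrightarrow> A e \<subseteq> R \<and> C e \<inter> R = {}" for e R
  \<comment> \<open>Survivors have all their colors in \<open>R\<close>, and \<open>R\<close> misses
    \<open>C e\<close>; so the other survivors lie in the graph where the ends of \<open>e\<close>
    are separated.\<close>
  have forest: "card {e \<in> E. survives e R} \<le> card {v \<in> V. vc v \<subseteq> R}" for R
  proof (rule card_forest_le)
    fix e assume e: "e \<in> {e \<in> E. survives e R}"
    then have "A e \<subseteq> R" "C e \<inter> R = {}" "e \<in> E" by (auto simp: survives_def)
    obtain x y where xy: "x \<in> V" "y \<in> V" "e = {x, y}"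
        "\<not> conn {e' \<in> E - {e}. A e' \<inter> C e = {}} x y"
      using sep_C[OF \<open>e \<in> E\<close>] by (auto simp: separates_def)
    have sub: "{e \<in> E. survives e R} - {e} \<subseteq> {e' \<in> E - {e}. A e' \<inter> C e = {}}"
      using \<open>C e \<inter> R = {}\<close> by (auto simp: survives_def)
    have "\<not> conn ({e \<in> E. survives e R} - {e}) x y"
      using conn_mono[OF _ sub] xy(4) by blast
    moreover have "vc x \<subseteq> R" "vc y \<subseteq> R"
      using vc_A[OF \<open>e \<in> E\<close>] xy(3) \<open>A e \<subseteq> R\<close> by blast+
    ultimately show "\<exists>x\<in>{v \<in> V. vc v \<subseteq> R}. \<exists>y\<in>{v \<in> V. vc v \<subseteq> R}.
        e = {x, y} \<and> \<not> conn ({e \<in> E. survives e R} - {e}) x y"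
      using xy by blast
  qed (use fin in auto)
  have "real (card E) * (p ^ k * (1 - p) ^ l) = (\<Sum>e\<in>E. p ^ k * (1 - p) ^ l)"
    by simp
  also have "\<dots> \<le> (\<Sum>e\<in>E. p ^ card (A e) * (1 - p) ^ card (C e \<inter> P))"
  proof (rule sum_mono)
    fix e assume e: "e \<in> E"
    have "card (C e \<inter> P) \<le> card (C e)"
      using C[OF e] by (intro card_mono) auto
    then have "card (C e \<inter> P) \<le> l" using C[OF e] by auto
    then show "p ^ k * (1 - p) ^ l \<le> p ^ card (A e) * (1 - p) ^ card (C e \<inter> P)"
      using p card_A[OF e] by (intro mult_mono power_decreasing) auto
  qed
  also have "\<dots> = (\<Sum>e\<in>E. \<Sum>R\<in>Pow P. sample_weight p P R * of_bool (survives e R))"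
  proof (rule sum.cong)
    fix e assume e: "e \<in> E"
    show "p ^ card (A e) * (1 - p) ^ card (C e \<inter> P) =
        (\<Sum>R\<in>Pow P. sample_weight p P R * of_bool (survives e R))"
      unfolding survives_def using C[OF e] e
      by (intro sum_sample_weight[symmetric] finP) (auto simp: P_def)
  qed simp
  also have "\<dots> = (\<Sum>R\<in>Pow P. sample_weight p P R * real (card {e \<in> E. survives e R}))"
    by (subst sum.swap) (simp add: fin(2) Int_def mult.commute)
  also have "\<dots> \<le> (\<Sum>R\<in>Pow P. sample_weight p P R * real (card {v \<in> V. vc v \<subseteq> R}))"
    using p forest by (intro sum_mono mult_left_mono) (auto simp: sample_weight_def)
  \<comment> \<open>The vacuous \<open>{} \<inter> R = {}\<close> gives the event the form of
    \<open>sum_sample_weight\<close> with \<open>B = {}\<close>.\<close>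
  also have "\<dots> = (\<Sum>v\<in>V. \<Sum>R\<in>Pow P. sample_weight p P R * of_bool (vc v \<subseteq> R \<and> {} \<inter> R = {}))"
    by (subst sum.swap) (simp add: fin(1) Int_def mult.commute)
  also have "\<dots> = (\<Sum>v\<in>V. p ^ j)"
  proof (rule sum.cong)
    fix v assume v: "v \<in> V"
    show "(\<Sum>R\<in>Pow P. sample_weight p P R * of_bool (vc v \<subseteq> R \<and> {} \<inter> R = {})) = p ^ j"
      using v card_vc[OF v] by (subst sum_sample_weight[OF finP]) (auto simp: P_def)
  qed simp
  finally show ?thesis by simp
qed

section \<open>Minimal connectivity-preserving subgraphs\<close>

text \<open>An edge is deleted exactly when this set meets \<open>C\<close>, which lets the three
  kinds of coloring be treated alike.\<close>

fun edge_colors :: "('v, 'c) coloring \<Rightarrow> 'v set \<Rightarrow> 'c set" where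
  "edge_colors (Edge_Coloring f) e = {f e}"
| "edge_colors (Vertex_Coloring g) e = g ` e"
| "edge_colors (Edge_Vertex_Coloring f g) e = insert (f e) (g ` e)"

fun vertex_colors :: "('v, 'c) coloring \<Rightarrow> 'v \<Rightarrow> 'c set" where
  "vertex_colors (Edge_Coloring f) v = {}"
| "vertex_colors (Vertex_Coloring g) v = {g v}"
| "vertex_colors (Edge_Vertex_Coloring f g) v = {g v}"

lemma hit_by_iff: "hit_by col C e \<longleftrightarrow> edge_colors col e \<inter> C \<noteq> {}"
  by (cases col) auto

lemma connected_in_delete_colors:
  "connected_in (delete_colors col H C) u v \<longleftrightarrow>
    u \<in> verts H \<and> v \<in> verts H \<and> conn {e \<in> edges H. edge_colors col e \<inter> C = {}} u v"
  by (simp add: connected_in_def delete_colors_def hit_by_iff)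

lemma simple_graph_finite_edges: "simple_graph G \<Longrightarrow> finite (edges G)"
  by (rule finite_subset[of _ "Pow (verts G)"]) (auto simp: simple_graph_def)

text \<open>\<open>H\<close> has the fewest edges, so dropping \<open>e\<close> breaks connectivity
  for some \<open>u\<close>, \<open>v\<close> and \<open>C\<close>. This \<open>C\<close> is the
  certificate: if the ends of \<open>e\<close> stayed connected, walks could be rerouted around
  \<open>e\<close>.\<close>

lemma preserves_connectivity_minimal:
  assumes "simple_graph G"
  obtains H where "preserves_connectivity col l G H"
    and "\<And>e. e \<in> edges H \<Longrightarrow> \<exists>C. separates (edge_colors col) l (verts G) (edges H) e C"
proof -
  have "preserves_connectivity col l G G"
    using assms by (auto simp: preserves_connectivity_def subgraph_def)
  then obtain H where H: "preserves_connectivity col l G H"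
    and min: "\<And>H'. preserves_connectivity col l G H' \<Longrightarrow> card (edges H) \<le> card (edges H')"
    using exists_least_iff[of "\<lambda>m. \<exists>H. preserves_connectivity col l G H \<and> card (edges H) = m"]
    by (metis leI)
  show thesis
  proof (rule that[OF H])
    fix e assume e: "e \<in> edges H"
    have sub: "subgraph H G" using H by (simp add: preserves_connectivity_def)
    then have sH: "simple_graph H" and VH: "verts H \<subseteq> verts G" by (auto simp: subgraph_def)
    \<comment> \<open>Taking \<open>u = v\<close> and deleting no color forces \<open>H\<close> to
      keep every vertex.\<close>
    have "v \<in> verts H" if "v \<in> verts G" for v
    proof -
      have "connected_in (delete_colors col G {}) v v"
        using that by (simp add: connected_in_delete_colors)
      then have "connected_in (delete_colors col H {}) v v"
        using H that unfolding preserves_connectivity_def by (metis card.empty finite.emptyI le0)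
      then show ?thesis by (simp add: connected_in_delete_colors)
    qed
    with VH have VH: "verts H = verts G" by auto
    define H' where "H' = \<lparr>verts = verts G, edges = edges H - {e}\<rparr>"
    have "card (edges H') < card (edges H)"
      using card_Diff1_less[OF simple_graph_finite_edges[OF sH] e] by (simp only: H'_def ugraph.simps)
    then have "\<not> preserves_connectivity col l G H'" using min leD by blast
    moreover have "subgraph H' G"
      using sub VH unfolding H'_def subgraph_def simple_graph_def by auto
    ultimately obtain u v C where C: "finite C" "card C \<le> l" and "u \<in> verts G" "v \<in> verts G"
      "connected_in (delete_colors col H' C) u v \<noteq> connected_in (delete_colors col G C) u v"
      unfolding preserves_connectivity_def by blast
    with H have "connected_in (delete_colors col H' C) u v \<noteq> connected_in (delete_colors col H C) u v"
      unfolding preserves_connectivity_def by blast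
    then have ne: "conn {e' \<in> edges H - {e}. edge_colors col e' \<inter> C = {}} u v \<noteq>
        conn {e' \<in> edges H. edge_colors col e' \<inter> C = {}} u v" (is "conn ?F' u v \<noteq> conn ?F u v")
      using \<open>u \<in> verts G\<close> \<open>v \<in> verts G\<close> by (simp add: connected_in_delete_colors H'_def VH)
    have "?F' \<subseteq> ?F" by auto
    with ne have conn: "conn ?F u v" "\<not> conn ?F' u v" using conn_mono[of ?F' u v ?F] by blast+
    \<comment> \<open>Otherwise deleting \<open>C\<close> removes \<open>e\<close> anyway, and
      dropping it changes nothing.\<close>
    have unhit: "edge_colors col e \<inter> C = {}"
    proof (rule ccontr)
      assume "edge_colors col e \<inter> C \<noteq> {}"
      then have "?F' = ?F" by auto
      with ne show False by (simp only:)
    qed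
    obtain x y where xy: "e = {x, y}" using sH e by (auto simp: simple_graph_def card_2_iff)
    have "?F = insert {x, y} ?F'" using xy e unhit by auto
    with conn(1) have "conn (insert {x, y} ?F') u v" by (simp only:)
    from conn(2) conn_replace_edge[OF this] have "\<not> conn ?F' x y" by (rule contrapos_nn)
    moreover have "x \<in> verts G" "y \<in> verts G" using sH e xy VH by (auto simp: simple_graph_def)
    ultimately show "\<exists>C. separates (edge_colors col) l (verts G) (edges H) e C"
      using xy C unhit unfolding separates_def by blast
  qed
qed

section \<open>Upper bounds\<close>

text \<open>For \<open>p = 1 / (2 * l)\<close> Bernoulli's inequality keeps
  \<open>(1 - p) ^ l\<close> at least \<open>1 / 2\<close>. The factor \<open>p ^ j\<close> cancels,
  so only the \<open>k\<close> further colors of an edge cost a factor \<open>2 * l\<close>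
  each.\<close>

lemma card_edges_le_of_sampling:
  fixes E n l k j :: nat
  assumes "l \<ge> 1" and "\<And>p::real. 0 \<le> p \<Longrightarrow> p \<le> 1 \<Longrightarrow> real E * (p ^ (k + j) * (1 - p) ^ l) \<le> real n * p ^ j"
  shows "real E \<le> 2 * (2 * real l) ^ k * real n"
proof -
  define p where "p = 1 / (2 * real l)"
  have p: "0 < p" "p \<le> 1" using assms(1) by (auto simp: p_def)
  have "1 + real l * (- p) \<le> (1 + (- p)) ^ l"
    using p by (intro Bernoulli_inequality) auto
  then have half: "1 / 2 \<le> (1 - p) ^ l" using assms(1) by (simp add: p_def)
  have "real E * p ^ k * (1 - p) ^ l * p ^ j \<le> real n * p ^ j"
    using assms(2)[of p] p by (simp add: power_add mult_ac)
  then have "real E * p ^ k * (1 - p) ^ l \<le> real n"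
    using p by simp
  moreover have "real E * p ^ k * (1 / 2) \<le> real E * p ^ k * (1 - p) ^ l"
    using half p by (intro mult_left_mono) auto
  ultimately have "real E * p ^ k \<le> 2 * real n" by simp
  then show ?thesis using assms(1) by (simp add: p_def power_divide field_simps)
qed

lemma upper_bound:
  fixes G :: "'v ugraph" and col :: "('v, 'c) coloring"
  assumes G: "simple_graph G"
  shows "\<exists>H. preserves_connectivity col l G H \<and>
    (l \<ge> 1 \<longrightarrow> real (card (edges H)) \<le> 8 * real (size_bound col l (card (verts G))))"
proof -
  obtain H where H: "preserves_connectivity col l G H"
    and sep: "\<And>e. e \<in> edges H \<Longrightarrow> \<exists>C. separates (edge_colors col) l (verts G) (edges H) e C"
    using preserves_connectivity_minimal[OF G, where col = col and l = l] by blast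
  have sH: "simple_graph H" using H by (simp add: preserves_connectivity_def subgraph_def)
  have fin: "finite (verts G)" "finite (edges H)" "\<And>e. e \<in> edges H \<Longrightarrow> finite e"
    and card2: "\<And>e. e \<in> edges H \<Longrightarrow> card e = 2"
    using G sH simple_graph_finite_edges[OF sH]
    by (auto simp: simple_graph_def intro: card_ge_0_finite)
  \<comment> \<open>Used with \<open>(k, j)\<close> equal to \<open>(1, 0)\<close> for colored
    edges, \<open>(1, 1)\<close> for colored vertices and \<open>(2, 1)\<close> for both. The
    factors are \<open>4 * l\<close>, \<open>4 * l\<close> and \<open>8 * l\<^sup>2\<close>, so the
    constant 8 covers all cases.\<close>
  have main: "real (card (edges H)) \<le> 2 * (2 * real l) ^ k * real (card (verts G))"
    if "l \<ge> 1" and "\<And>e. e \<in> edges H \<Longrightarrow> card (edge_colors col e) \<le> k + j"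
      and "\<And>v. card (vertex_colors col v) = j" for k j
  proof (rule card_edges_le_of_sampling[OF that(1)])
    fix p :: real assume "0 \<le> p" "p \<le> 1"
    show "real (card (edges H)) * (p ^ (k + j) * (1 - p) ^ l) \<le> real (card (verts G)) * p ^ j"
    proof (rule card_sparse_le[OF fin(1,2) _ _ that(2,3) _ \<open>0 \<le> p\<close> \<open>p \<le> 1\<close> sep])
      show "finite (edge_colors col e)" if "e \<in> edges H" for e
        using fin(3)[OF that] by (cases col) auto
      show "finite (vertex_colors col v)" for v by (cases col) auto
      show "vertex_colors col x \<subseteq> edge_colors col e" if "x \<in> e" for e x
        using that by (cases col) auto
    qed
  qed
  have image_le: "card (g ` e) \<le> 2" if "e \<in> edges H" for e and g :: "'v \<Rightarrow> 'c"
    using card_image_le[of e g] fin(3) card2 that by force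
  have "real (card (edges H)) \<le> 8 * real (size_bound col l (card (verts G)))" if l: "l \<ge> 1"
  proof (cases col)
    case (Edge_Coloring f)
    then show ?thesis using main[OF l, of 1 0] by simp
  next
    case (Vertex_Coloring g)
    then have "real (card (edges H)) \<le> 4 * (real l * real (card (verts G)))"
      using main[OF l, of 1 1] image_le by (simp add: numeral_2_eq_2 mult.assoc)
    also have "\<dots> \<le> 8 * (real l * real (card (verts G)))" by simp
    finally show ?thesis using Vertex_Coloring by simp
  next
    case (Edge_Vertex_Coloring f g)
    have "card (insert (f e) (g ` e)) \<le> 3" if "e \<in> edges H" for e
      using card_insert_le_m1[of 3 "g ` e" "f e"] image_le[OF that, of g] by simp
    then show ?thesis using main[OF l, of 2 1] Edge_Vertex_Coloring
      by (simp add: power2_eq_square)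
  qed
  with H show ?thesis by blast
qed

section \<open>Lower bounds\<close>

definition complete_bipartite :: "nat \<Rightarrow> nat \<Rightarrow> nat ugraph" where
  "complete_bipartite k n = \<lparr>verts = {..<n}, edges = (\<lambda>(a, b). {a, b}) ` ({..<k} \<times> {k..<n})\<rparr>"

lemma simple_complete_bipartite:
  assumes "k \<le> n"
  shows "simple_graph (complete_bipartite k n)" "card (verts (complete_bipartite k n)) = n"
  using assms by (auto simp: complete_bipartite_def simple_graph_def card_insert_if)

lemma card_edges_complete_bipartite: "card (edges (complete_bipartite k n)) = k * (n - k)"
proof -
  have "inj_on (\<lambda>(a, b). {a, b}) ({..<k} \<times> {k..<n})"
    by (auto simp: inj_on_def doubleton_eq_iff)
  then show ?thesis by (simp add: complete_bipartite_def card_image card_cartesian_product)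
qed

text \<open>Deleting the set \<open>C\<close> for \<open>a\<close> leaves exactly the edges at
  \<open>a\<close>, so \<open>a\<close> is the only neighbor of each large-side vertex
  \<open>b\<close>. Keeping \<open>b\<close> connected to \<open>a\<close> forces
  \<open>{a, b}\<close> into \<open>H\<close>.\<close>

lemma complete_bipartite_incompressible:
  assumes "k \<le> n"
    and iso: "\<And>a. a < k \<Longrightarrow> \<exists>C. finite C \<and> card C \<le> l \<and>
      (\<forall>a' < k. \<forall>b. k \<le> b \<and> b < n \<longrightarrow> (hit_by col C {a', b} \<longleftrightarrow> a' \<noteq> a))"
    and H: "preserves_connectivity col l (complete_bipartite k n) H"
  shows "k * (n - k) \<le> card (edges H)"
proof -
  let ?G = "complete_bipartite k n"
  have sub: "edges H \<subseteq> edges ?G" and "simple_graph H"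
    using H by (auto simp: preserves_connectivity_def subgraph_def)
  have "{a, b} \<in> edges H" if ab: "a < k" "k \<le> b" "b < n" for a b
  proof -
    obtain C where C: "finite C" "card C \<le> l"
      and hit: "\<And>a' b. a' < k \<Longrightarrow> k \<le> b \<Longrightarrow> b < n \<Longrightarrow> hit_by col C {a', b} \<longleftrightarrow> a' \<noteq> a"
      using iso[OF ab(1)] by blast
    have "{b, a} \<in> edges (delete_colors col ?G C)"
      using hit[OF ab] ab by (auto simp: delete_colors_def complete_bipartite_def insert_commute)
    then have "connected_in (delete_colors col ?G C) b a"
      using ab assms(1) unfolding connected_in_def
      by (intro conjI r_into_rtranclp) (auto simp: delete_colors_def complete_bipartite_def)
    then have "connected_in (delete_colors col H C) b a"
      using H C ab assms(1) by (auto simp: preserves_connectivity_def complete_bipartite_def)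
    \<comment> \<open>Since \<open>a < k \<le> b\<close>, the two vertices differ and the walk from
      \<open>b\<close> has a first edge.\<close>
    then obtain z where z: "{b, z} \<in> edges H" "\<not> hit_by col C {b, z}"
      using ab by (auto simp: connected_in_def delete_colors_def elim: converse_rtranclpE)
    have "{b, z} \<in> edges ?G" using sub z by blast
    then obtain a' b' where "a' < k" "k \<le> b'" "b' < n" "{b, z} = {a', b'}"
      by (auto simp: complete_bipartite_def)
    then have "z = a" using ab z hit by (auto simp: doubleton_eq_iff insert_commute)
    with z show ?thesis by (simp add: insert_commute)
  qed
  then have "edges ?G \<subseteq> edges H" by (auto simp: complete_bipartite_def)
  then show ?thesis
    using card_mono[OF simple_graph_finite_edges[OF \<open>simple_graph H\<close>]]
    by (simp flip: card_edges_complete_bipartite)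
qed

lemma lower_bound_linear:
  assumes "1 \<le> l" "l \<le> n" "2 \<le> n" "k = (l + 1) div 2"
  shows "k \<le> n" "1 / 8 * (real l * real n) \<le> real (k * (n - k))"
proof -
  show "k \<le> n" using assms by auto
  \<comment> \<open>Rounding up gives \<open>k\<close> at least half of \<open>l\<close>; as
    \<open>l \<le> n\<close> and \<open>2 \<le> n\<close>, at least a quarter of the vertices remain
    on the large side.\<close>
  have "l \<le> 2 * k" "n \<le> 4 * (n - k)" using assms by auto
  then have "l * n \<le> 2 * k * (4 * (n - k))" by (rule mult_le_mono)
  then have "real (l * n) \<le> real (8 * (k * (n - k)))" by (intro of_nat_mono) simp
  then show "1 / 8 * (real l * real n) \<le> real (k * (n - k))" by simp
qed

lemma lower_bound_quadratic:
  assumes "1 \<le> l" "l\<^sup>2 \<le> n" "2 \<le> n" "m = (l + 1) div 2"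
  shows "m\<^sup>2 \<le> n" "1 / 8 * ((real l)\<^sup>2 * real n) \<le> real (m\<^sup>2 * (n - m\<^sup>2))"
proof -
  \<comment> \<open>For \<open>l \<ge> 2\<close>, \<open>m\<close> is at most two thirds of
    \<open>l\<close>, so \<open>m\<^sup>2\<close> is at most four ninths of \<open>n\<close>; for
    \<open>l = 1\<close> the claim is \<open>2 \<le> n\<close>.\<close>
  have half: "2 * m\<^sup>2 \<le> n"
  proof (cases "l = 1")
    case False
    then have "3 * m \<le> 2 * l" using assms by auto
    then have "(3 * m)\<^sup>2 \<le> (2 * l)\<^sup>2" by (rule power_mono) simp
    then show ?thesis using assms(2) by (simp add: power_mult_distrib)
  qed (use assms in simp)
  then show "m\<^sup>2 \<le> n" by simp
  have "l\<^sup>2 \<le> (2 * m)\<^sup>2" using assms by (intro power_mono) auto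
  then have "l\<^sup>2 * n \<le> (2 * m)\<^sup>2 * (2 * (n - m\<^sup>2))" using half by (intro mult_le_mono) auto
  then have "real (l\<^sup>2 * n) \<le> real (8 * (m\<^sup>2 * (n - m\<^sup>2)))"
    by (intro of_nat_mono) (simp add: power_mult_distrib)
  then show "1 / 8 * ((real l)\<^sup>2 * real n) \<le> real (m\<^sup>2 * (n - m\<^sup>2))" by simp
qed

lemma lower_bound_edge_coloring:
  assumes "1 \<le> l" "l \<le> n" "2 \<le> n"
  shows "\<exists>(G :: nat ugraph) (f :: nat set \<Rightarrow> nat). simple_graph G \<and> card (verts G) = n \<and>
    (\<forall>H. preserves_connectivity (Edge_Coloring f) l G H \<longrightarrow>
      1 / 8 * (real l * real n) \<le> real (card (edges H)))"
proof -
  define k where "k = (l + 1) div 2"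
  note k = lower_bound_linear[OF assms k_def]
  have "\<exists>C. finite C \<and> card C \<le> l \<and> (\<forall>a' < k. \<forall>b. k \<le> b \<and> b < n \<longrightarrow>
      (hit_by (Edge_Coloring Min) C {a', b} \<longleftrightarrow> a' \<noteq> a))" if "a < k" for a :: nat
    \<comment> \<open>\<open>Min\<close> colors \<open>{a', b}\<close> with its small-side end
      \<open>a'\<close>, so the other \<open>k - 1\<close> small-side indices are the colors to
      delete.\<close>
    using that by (intro exI[of _ "{..<k} - {a}"]) (auto simp: k_def card_Diff_singleton)
  then have "1 / 8 * (real l * real n) \<le> real (card (edges H))"
    if "preserves_connectivity (Edge_Coloring Min) l (complete_bipartite k n) H" for H
    using k(2) of_nat_mono[OF complete_bipartite_incompressible[OF k(1) _ that]]
    by (meson order_trans)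
  then show ?thesis using simple_complete_bipartite[OF k(1)] by blast
qed

lemma lower_bound_vertex_coloring:
  assumes "1 \<le> l" "l \<le> n" "2 \<le> n"
  shows "\<exists>(G :: nat ugraph) (g :: nat \<Rightarrow> nat). simple_graph G \<and> card (verts G) = n \<and>
    (\<forall>H. preserves_connectivity (Vertex_Coloring g) l G H \<longrightarrow>
      1 / 8 * (real l * real n) \<le> real (card (edges H)))"
proof -
  define k where "k = (l + 1) div 2"
  note k = lower_bound_linear[OF assms k_def]
  have "\<exists>C. finite C \<and> card C \<le> l \<and> (\<forall>a' < k. \<forall>b. k \<le> b \<and> b < n \<longrightarrow>
      (hit_by (Vertex_Coloring id) C {a', b} \<longleftrightarrow> a' \<noteq> a))" if "a < k" for a :: nat
    \<comment> \<open>All vertices have distinct colors, and no large-side color lies in the deleted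
      set.\<close>
    using that by (intro exI[of _ "{..<k} - {a}"]) (auto simp: k_def card_Diff_singleton)
  then have "1 / 8 * (real l * real n) \<le> real (card (edges H))"
    if "preserves_connectivity (Vertex_Coloring id) l (complete_bipartite k n) H" for H
    using k(2) of_nat_mono[OF complete_bipartite_incompressible[OF k(1) _ that]]
    by (meson order_trans)
  then show ?thesis using simple_complete_bipartite[OF k(1)] by blast
qed

lemma lower_bound_edge_vertex_coloring:
  assumes "1 \<le> l" "l\<^sup>2 \<le> n" "2 \<le> n"
  shows "\<exists>(G :: nat ugraph) (f :: nat set \<Rightarrow> nat) (g :: nat \<Rightarrow> nat).
    simple_graph G \<and> card (verts G) = n \<and>
    (\<forall>H. preserves_connectivity (Edge_Vertex_Coloring f g) l G H \<longrightarrow>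
      1 / 8 * ((real l)\<^sup>2 * real n) \<le> real (card (edges H)))"
proof -
  define m where "m = (l + 1) div 2"
  note m = lower_bound_quadratic[OF assms m_def]
  have "m > 0" using assms(1) by (auto simp: m_def)
  \<comment> \<open>The quotient of \<open>a\<close> by \<open>m\<close> colors the vertex, with
    colors below \<open>m\<close>; the remainder colors its edges, shifted by \<open>m\<close> to
    keep the palettes apart. \<open>Min e\<close> is the small-side end of \<open>e\<close>, and
    large-side vertices get the color \<open>2 * m\<close>, which is never deleted.\<close>
  define f where "f e = m + Min e mod m" for e
  define g where "g a = (if a < m\<^sup>2 then a div m else 2 * m)" for a
  have "\<exists>C. finite C \<and> card C \<le> l \<and> (\<forall>a' < m\<^sup>2. \<forall>b. m\<^sup>2 \<le> b \<and> b < n \<longrightarrow>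
      (hit_by (Edge_Vertex_Coloring f g) C {a', b} \<longleftrightarrow> a' \<noteq> a))" if a: "a < m\<^sup>2" for a :: nat
  proof (intro exI conjI allI impI)
    \<comment> \<open>All \<open>2 * m\<close> code colors except the two that encode
      \<open>a\<close>; any other \<open>a'\<close> differs from \<open>a\<close> in quotient or
      remainder and is hit there.\<close>
    let ?C = "{..<2 * m} - {a div m, m + a mod m}"
    have div: "x div m < m" if "x < m\<^sup>2" for x
      using that by (simp add: less_mult_imp_div_less power2_eq_square)
    have "card ?C = 2 * m - card {a div m, m + a mod m}"
      using div[OF a] \<open>m > 0\<close> by (subst card_Diff_subset) auto
    also have "card {a div m, m + a mod m} = 2" using div[OF a] by auto
    finally show "card ?C \<le> l" by (simp add: m_def)
    show "finite ?C" by simp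
    fix a' b assume "a' < m\<^sup>2" "m\<^sup>2 \<le> b \<and> b < n"
    then have "f {a', b} = m + a' mod m" "g a' = a' div m" "g b = 2 * m"
      by (auto simp: f_def g_def)
    moreover have "a' div m < m" "a' mod m < m" "a div m < m"
      using div a \<open>a' < m\<^sup>2\<close> \<open>m > 0\<close> by auto
    moreover have "a' = a \<longleftrightarrow> a' div m = a div m \<and> a' mod m = a mod m"
      by (metis div_mult_mod_eq)
    ultimately show "hit_by (Edge_Vertex_Coloring f g) ?C {a', b} \<longleftrightarrow> a' \<noteq> a"
      by auto
  qed
  then have "1 / 8 * ((real l)\<^sup>2 * real n) \<le> real (card (edges H))"
    if "preserves_connectivity (Edge_Vertex_Coloring f g) l (complete_bipartite (m\<^sup>2) n) H" for H
    using m(2) of_nat_mono[OF complete_bipartite_incompressible[OF m(1) _ that]]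
    by (meson order_trans)
  then show ?thesis using simple_complete_bipartite[OF m(1)] by blast
qed

theorem theorem1p3:
  shows
   "(\<exists>K::real. \<forall>(G :: 'v ugraph) (col :: ('v, 'c) coloring) l.
       simple_graph G \<longrightarrow>
       (\<exists>H. preserves_connectivity col l G H \<and>
            (l \<ge> 1 \<longrightarrow> real (card (edges H)) \<le> K * real (size_bound col l (card (verts G)))))) \<and>
    (\<exists>c::real > 0. \<forall>l n. 1 \<le> l \<and> l \<le> n \<and> 2 \<le> n \<longrightarrow>
       (\<exists>(G :: nat ugraph) (f :: nat set \<Rightarrow> nat). simple_graph G \<and> card (verts G) = n \<and>
          (\<forall>H. preserves_connectivity (Edge_Coloring f) l G H \<longrightarrow>
               c * (real l * real n) \<le> real (card (edges H))))) \<and>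
    (\<exists>c::real > 0. \<forall>l n. 1 \<le> l \<and> l \<le> n \<and> 2 \<le> n \<longrightarrow>
       (\<exists>(G :: nat ugraph) (g :: nat \<Rightarrow> nat). simple_graph G \<and> card (verts G) = n \<and>
          (\<forall>H. preserves_connectivity (Vertex_Coloring g) l G H \<longrightarrow>
               c * (real l * real n) \<le> real (card (edges H))))) \<and>
    (\<exists>c::real > 0. \<forall>l n. 1 \<le> l \<and> l\<^sup>2 \<le> n \<and> 2 \<le> n \<longrightarrow>
       (\<exists>(G :: nat ugraph) (f :: nat set \<Rightarrow> nat) (g :: nat \<Rightarrow> nat).
          simple_graph G \<and> card (verts G) = n \<and>
          (\<forall>H. preserves_connectivity (Edge_Vertex_Coloring f g) l G H \<longrightarrow>
               c * ((real l)\<^sup>2 * real n) \<le> real (card (edges H)))))"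
  using upper_bound lower_bound_edge_coloring lower_bound_vertex_coloring
    lower_bound_edge_vertex_coloring
  by (intro conjI exI[of _ "8::real"] exI[of _ "1/8::real"]) auto

end
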